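(* Let $\mathbf{L}$ be any logic between $\mathbf{B}$ and $\mathbf{RM}$. Then quantifier elimination fails for Presburger arithmetic in $\mathbf{L}$: writing $\mathrm{Pr}$ for the theory of Presburger arithmetic, there is a formula $A$ in its language such that for no quantifier-free formula $B$ in that language do we have $\mathrm{Pr}\vDash_{\mathbf{L}} A\leftrightarrow B$.
   Context: Language: first-order formulas built with $\neg,\land,\lor,\rightarrow,\forall,\exists,\bot,\top$ and the logical predicate $=$. $A\leftrightarrow B$ abbreviates $(A\rightarrow B)\land(B\rightarrow A)$. A $\mathbf{B}$-frame is $\langle W,R,{}^*,s\rangle$ with $W\neq\varnothing$, $R\subseteq W^3$, ${}^*:W\to W$, $s\in W$, such that for all $\alpha,\beta,\gamma,\delta\in W$: $Rs\alpha\alpha$; $Rs\alpha\beta$ and $R\beta\gamma\delta$ imply $R\alpha\gamma\delta$; $\alpha^{**}=\alpha$; $Rs\alpha\beta$ implies $Rs\beta^*\alpha^*$. A $\mathbf{B}$-model $M=\langle W,R,D,{}^*,s,V\rangle$ adds a nonempty set $D$ and a valuation $V$ with $V(w,P)\subseteq D^n$ for each $w\in W$ and $n$-ary predicate $P$, such that $Rs\alpha\beta$ implies $V(\alpha,P)\subseteq V(\beta,P)$; function and constant symbols are interpreted on $D$ independently of worlds; $=$ is interpreted as real identity on $D$ at every world. Truth at a world $w$ under an assignment $\overline{a}$ of elements of $D$ to variables: atomic formulas according to $V(w,\cdot)$; $\top$ always, $\bot$ never; $\land,\lor$ as usual at $w$; $M,w\vDash\neg A[\overline a]$ iff $M,w^*\nvDash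 A[\overline a]$; $M,w\vDash (A\rightarrow B)[\overline a]$ iff for all $w_1,w_2$ with $Rww_1w_2$, $M,w_1\vDash A[\overline a]$ implies $M,w_2\vDash B[\overline a]$; $\forall x$, $\exists x$ range over $D$ at $w$. A formula with free variables holds at $w$ in $M$ (without assignment) if it holds under all assignments. An $\mathbf{RM}$-frame is a $\mathbf{B}$-frame such that for all $\alpha,\beta,\gamma,\delta$: $R\alpha\beta\gamma$ implies $R\alpha\gamma^*\beta^*$; $R\alpha\beta\gamma$ implies $R\beta\alpha\gamma$; $R\alpha\alpha\alpha$; if there is $x$ with $R\alpha\beta x$ and $Rx\gamma\delta$ then there is $y$ with $R\alpha y\delta$ and $R\beta\gamma y$; $R\alpha\beta\gamma$ implies $Rs\alpha\gamma$ or $Rs\beta\gamma$. A logic $\mathbf{L}$ extending $\mathbf{B}$ is given by a class of $\mathbf{B}$-frames ($\mathbf{L}$-frames); $\mathbf{L}$-models are the $\mathbf{B}$-models on $\mathbf{L}$-frames. $\mathbf{L}$ lies between $\mathbf{B}$ and $\mathbf{RM}$ if every $\mathbf{RM}$-frame is an $\mathbf{L}$-frame. $\Gamma\vDash_{\mathbf{L}}A$ means: for every $\mathbf{L}$-model $M$, if $M,s\vDash\Gamma$ then $M,s\vDash A$. Presburger arithmetic, in the signature with binary predicate $<$, unary predicates $P_n$ ($n>1$), binary function $+$, constants $0,1$, has the axioms: $\forall x(x<x\rightarrow\bot)$; $\forall x,y(x=y\lor x<y\lor y<x)$; $\forall x,y,z((x<y\land y<z)\rightarrow x<z)$; $\forall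 x,y,z(x<y\rightarrow x+z<y+z)$; $\forall x,y,z((x+y)+z=x+(y+z))$; $\forall x(x+0=x)$; $\forall x,y(x+y=y+x)$; $0<1$; $\forall x((x=0\lor x<0)\lor(1<x\lor x=1))$; for each $n>1$, $\forall x(P_n(x)\leftrightarrow\exists y(x=\underbrace{y+\dots+y}_{n\text{ times}}))$; for each $n>1$, $\forall x\bigvee_{i=0}^{n-1}\bigl(P_n(x+\underbrace{1+\dots+1}_{i\text{ times}})\land\bigwedge_{j\neq i}(P_n(x+\underbrace{1+\dots+1}_{j\text{ times}})\rightarrow\bot)\bigr)$, where $j$ ranges over $\{0,\dots,n-1\}\setminus\{i\}$. A theory $T$ admits quantifier elimination in $\mathbf{L}$ if for every formula $A$ there is a quantifier-free formula $B$ with $T\vDash_{\mathbf{L}}A\leftrightarrow B$. *)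

theory Defs
  imports Main
begin

section \<open>First-order languages\<close>

text \<open>A signature assigns arities to symbols; \<open>None\<close> means that the symbol does not belong to
  the signature. Constants are function symbols of arity 0. Terms and formulas as such are
  raw syntax; the formulas of a language are those satisfying \<open>formula_of\<close>.\<close>

record ('f, 'p) signature =
  fun_arity :: "'f \<Rightarrow> nat option"
  pred_arity :: "'p \<Rightarrow> nat option"

datatype 'f tm = Var nat | Fun 'f "'f tm list"

datatype ('f, 'p) fm =
    Top
  | Bot
  | Eq "'f tm" "'f tm"
  | Pred 'p "'f tm list"
  | Neg "('f, 'p) fm"
  | And "('f, 'p) fm" "('f, 'p) fm"
  | Or "('f, 'p) fm" "('f, 'p) fm"
  | Imp "('f, 'p) fm" "('f, 'p) fm"
  | All nat "('f, 'p) fm"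
  | Ex nat "('f, 'p) fm"

definition Iff :: "('f, 'p) fm \<Rightarrow> ('f, 'p) fm \<Rightarrow> ('f, 'p) fm" where
  "Iff A B = And (Imp A B) (Imp B A)"

fun term_of :: "('f, 'p) signature \<Rightarrow> 'f tm \<Rightarrow> bool" where
  "term_of \<Sigma> (Var x) \<longleftrightarrow> True"
| "term_of \<Sigma> (Fun f ts) \<longleftrightarrow> fun_arity \<Sigma> f = Some (length ts) \<and> (\<forall>t\<in>set ts. term_of \<Sigma> t)"

fun formula_of :: "('f, 'p) signature \<Rightarrow> ('f, 'p) fm \<Rightarrow> bool" where
  "formula_of \<Sigma> Top \<longleftrightarrow> True"
| "formula_of \<Sigma> Bot \<longleftrightarrow> True"
| "formula_of \<Sigma> (Eq t u) \<longleftrightarrow> term_of \<Sigma> t \<and> term_of \<Sigma> u"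
| "formula_of \<Sigma> (Pred P ts) \<longleftrightarrow> pred_arity \<Sigma> P = Some (length ts) \<and> (\<forall>t\<in>set ts. term_of \<Sigma> t)"
| "formula_of \<Sigma> (Neg A) \<longleftrightarrow> formula_of \<Sigma> A"
| "formula_of \<Sigma> (And A B) \<longleftrightarrow> formula_of \<Sigma> A \<and> formula_of \<Sigma> B"
| "formula_of \<Sigma> (Or A B) \<longleftrightarrow> formula_of \<Sigma> A \<and> formula_of \<Sigma> B"
| "formula_of \<Sigma> (Imp A B) \<longleftrightarrow> formula_of \<Sigma> A \<and> formula_of \<Sigma> B"
| "formula_of \<Sigma> (All x A) \<longleftrightarrow> formula_of \<Sigma> A"
| "formula_of \<Sigma> (Ex x A) \<longleftrightarrow> formula_of \<Sigma> A"

fun quantifier_free :: "('f, 'p) fm \<Rightarrow> bool" where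
  "quantifier_free (Neg A) \<longleftrightarrow> quantifier_free A"
| "quantifier_free (And A B) \<longleftrightarrow> quantifier_free A \<and> quantifier_free B"
| "quantifier_free (Or A B) \<longleftrightarrow> quantifier_free A \<and> quantifier_free B"
| "quantifier_free (Imp A B) \<longleftrightarrow> quantifier_free A \<and> quantifier_free B"
| "quantifier_free (All x A) \<longleftrightarrow> False"
| "quantifier_free (Ex x A) \<longleftrightarrow> False"
| "quantifier_free _ \<longleftrightarrow> True"


section \<open>Frames and logics\<close>

text \<open>The set of worlds is an explicit carrier inside the type \<open>'w\<close>; the values of \<open>star\<close>
  outside the carrier are irrelevant.\<close>

record 'w frame =
  worlds :: "'w set"
  acc :: "'w \<Rightarrow> 'w \<Rightarrow> 'w \<Rightarrow> bool"
  star :: "'w \<Rightarrow> 'w"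
  base :: 'w

definition B_frame :: "'w frame \<Rightarrow> bool" where
  "B_frame F \<longleftrightarrow>
     (let W = worlds F; R = acc F; st = star F; s = base F in
       W \<noteq> {} \<and>
       (\<forall>\<alpha> \<beta> \<gamma>. R \<alpha> \<beta> \<gamma> \<longrightarrow> \<alpha> \<in> W \<and> \<beta> \<in> W \<and> \<gamma> \<in> W) \<and>
       (\<forall>\<alpha>\<in>W. st \<alpha> \<in> W) \<and>
       s \<in> W \<and>
       (\<forall>\<alpha>\<in>W. R s \<alpha> \<alpha>) \<and>
       (\<forall>\<alpha>\<in>W. \<forall>\<beta>\<in>W. \<forall>\<gamma>\<in>W. \<forall>\<delta>\<in>W. R s \<alpha> \<beta> \<and> R \<beta> \<gamma> \<delta> \<longrightarrow> R \<alpha> \<gamma> \<delta>) \<and>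
       (\<forall>\<alpha>\<in>W. st (st \<alpha>) = \<alpha>) \<and>
       (\<forall>\<alpha>\<in>W. \<forall>\<beta>\<in>W. R s \<alpha> \<beta> \<longrightarrow> R s (st \<beta>) (st \<alpha>)))"

definition RM_frame :: "'w frame \<Rightarrow> bool" where
  "RM_frame F \<longleftrightarrow>
     (let W = worlds F; R = acc F; st = star F; s = base F in
       B_frame F \<and>
       (\<forall>\<alpha>\<in>W. \<forall>\<beta>\<in>W. \<forall>\<gamma>\<in>W. R \<alpha> \<beta> \<gamma> \<longrightarrow> R \<alpha> (st \<gamma>) (st \<beta>)) \<and>
       (\<forall>\<alpha>\<in>W. \<forall>\<beta>\<in>W. \<forall>\<gamma>\<in>W. R \<alpha> \<beta> \<gamma> \<longrightarrow> R \<beta> \<alpha> \<gamma>) \<and>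
       (\<forall>\<alpha>\<in>W. R \<alpha> \<alpha> \<alpha>) \<and>
       (\<forall>\<alpha>\<in>W. \<forall>\<beta>\<in>W. \<forall>\<gamma>\<in>W. \<forall>\<delta>\<in>W.
          (\<exists>x\<in>W. R \<alpha> \<beta> x \<and> R x \<gamma> \<delta>) \<longrightarrow> (\<exists>y\<in>W. R \<alpha> y \<delta> \<and> R \<beta> \<gamma> y)) \<and>
       (\<forall>\<alpha>\<in>W. \<forall>\<beta>\<in>W. \<forall>\<gamma>\<in>W. R \<alpha> \<beta> \<gamma> \<longrightarrow> R s \<alpha> \<gamma> \<or> R s \<beta> \<gamma>))"

text \<open>A logic extending \<open>B\<close> is given by its frames.\<close>

definition extends_B :: "'w frame set \<Rightarrow> bool" where
  "extends_B L \<longleftrightarrow> (\<forall>F\<in>L. B_frame F)"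

definition between_B_and_RM :: "'w frame set \<Rightarrow> bool" where
  "between_B_and_RM L \<longleftrightarrow> extends_B L \<and> (\<forall>F. RM_frame F \<longrightarrow> F \<in> L)"


section \<open>Models, truth and consequence\<close>

text \<open>As for worlds, the domain is a carrier inside the type \<open>'d\<close>. Function symbols are
  interpreted independently of worlds. Interpretations of symbols outside the signature, and
  on arguments of the wrong length or outside the domain, are unconstrained and irrelevant.\<close>

record ('w, 'd, 'f, 'p) model =
  frame_of :: "'w frame"
  domain_of :: "'d set"
  fun_int :: "'f \<Rightarrow> 'd list \<Rightarrow> 'd"
  val :: "'w \<Rightarrow> 'p \<Rightarrow> 'd list set"

definition B_model :: "('f, 'p) signature \<Rightarrow> ('w, 'd, 'f, 'p) model \<Rightarrow> bool" where
  "B_model \<Sigma> M \<longleftrightarrow>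
     (let F = frame_of M; D = domain_of M in
       B_frame F \<and>
       D \<noteq> {} \<and>
       (\<forall>f n ds. fun_arity \<Sigma> f = Some n \<and> length ds = n \<and> set ds \<subseteq> D \<longrightarrow> fun_int M f ds \<in> D) \<and>
       (\<forall>w\<in>worlds F. \<forall>P n. pred_arity \<Sigma> P = Some n \<longrightarrow>
          val M w P \<subseteq> {ds. length ds = n \<and> set ds \<subseteq> D}) \<and>
       (\<forall>\<alpha>\<in>worlds F. \<forall>\<beta>\<in>worlds F. \<forall>P n. pred_arity \<Sigma> P = Some n \<longrightarrow>
          acc F (base F) \<alpha> \<beta> \<longrightarrow> val M \<alpha> P \<subseteq> val M \<beta> P))"

definition assignment :: "('w, 'd, 'f, 'p) model \<Rightarrow> (nat \<Rightarrow> 'd) \<Rightarrow> bool" where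
  "assignment M a \<longleftrightarrow> (\<forall>x. a x \<in> domain_of M)"

fun tm_val :: "('w, 'd, 'f, 'p) model \<Rightarrow> (nat \<Rightarrow> 'd) \<Rightarrow> 'f tm \<Rightarrow> 'd" where
  "tm_val M a (Var x) = a x"
| "tm_val M a (Fun f ts) = fun_int M f (map (tm_val M a) ts)"

fun sat :: "('w, 'd, 'f, 'p) model \<Rightarrow> 'w \<Rightarrow> (nat \<Rightarrow> 'd) \<Rightarrow> ('f, 'p) fm \<Rightarrow> bool" where
  "sat M w a Top \<longleftrightarrow> True"
| "sat M w a Bot \<longleftrightarrow> False"
| "sat M w a (Eq t u) \<longleftrightarrow> tm_val M a t = tm_val M a u"
| "sat M w a (Pred P ts) \<longleftrightarrow> map (tm_val M a) ts \<in> val M w P"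
| "sat M w a (Neg A) \<longleftrightarrow> \<not> sat M (star (frame_of M) w) a A"
| "sat M w a (And A B) \<longleftrightarrow> sat M w a A \<and> sat M w a B"
| "sat M w a (Or A B) \<longleftrightarrow> sat M w a A \<or> sat M w a B"
| "sat M w a (Imp A B) \<longleftrightarrow>
     (\<forall>w1 \<in> worlds (frame_of M). \<forall>w2 \<in> worlds (frame_of M).
        acc (frame_of M) w w1 w2 \<longrightarrow> sat M w1 a A \<longrightarrow> sat M w2 a B)"
| "sat M w a (All x A) \<longleftrightarrow> (\<forall>d \<in> domain_of M. sat M w (a(x := d)) A)"
| "sat M w a (Ex x A) \<longleftrightarrow> (\<exists>d \<in> domain_of M. sat M w (a(x := d)) A)"

definition holds_at :: "('w, 'd, 'f, 'p) model \<Rightarrow> 'w \<Rightarrow> ('f, 'p) fm \<Rightarrow> bool" where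
  "holds_at M w A \<longleftrightarrow> (\<forall>a. assignment M a \<longrightarrow> sat M w a A)"

text \<open>Consequence in the logic given by \<open>L\<close>. The first argument only fixes the type in which
  the domains of the models live, since this type does not occur in the other arguments. Only
  models with worlds in \<open>'w\<close> and domain in \<open>'d\<close> are considered; larger types give more models,
  so failure of consequence over given types is failure over all larger ones.\<close>

definition consequence ::
    "'d itself \<Rightarrow> ('f, 'p) signature \<Rightarrow> 'w frame set \<Rightarrow> ('f, 'p) fm set \<Rightarrow> ('f, 'p) fm \<Rightarrow> bool" where
  "consequence _ \<Sigma> L \<Gamma> A \<longleftrightarrow>
     (\<forall>M :: ('w, 'd, 'f, 'p) model.
        B_model \<Sigma> M \<and> frame_of M \<in> L \<longrightarrow>
        (\<forall>G\<in>\<Gamma>. holds_at M (base (frame_of M)) G) \<longrightarrow> holds_at M (base (frame_of M)) A)"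


section \<open>Presburger arithmetic\<close>

datatype pr_fun = PZero | POne | PPlus

datatype pr_pred = PLess | PDiv nat

text \<open>The predicate symbol \<open>PDiv n\<close> stands for \<open>P\<^sub>n\<close>, which exists only for \<open>n > 1\<close>.\<close>

definition pr_sig :: "(pr_fun, pr_pred) signature" where
  "pr_sig =
    \<lparr> fun_arity = (\<lambda>f. case f of PZero \<Rightarrow> Some 0 | POne \<Rightarrow> Some 0 | PPlus \<Rightarrow> Some 2),
      pred_arity = (\<lambda>P. case P of PLess \<Rightarrow> Some 2 | PDiv n \<Rightarrow> if n > 1 then Some 1 else None) \<rparr>"

type_synonym pr_tm = "pr_fun tm"
type_synonym pr_fm = "(pr_fun, pr_pred) fm"

abbreviation pr_zero :: pr_tm where "pr_zero \<equiv> Fun PZero []"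
abbreviation pr_one :: pr_tm where "pr_one \<equiv> Fun POne []"
abbreviation pr_plus :: "pr_tm \<Rightarrow> pr_tm \<Rightarrow> pr_tm" where "pr_plus t u \<equiv> Fun PPlus [t, u]"
abbreviation pr_less :: "pr_tm \<Rightarrow> pr_tm \<Rightarrow> pr_fm" where "pr_less t u \<equiv> Pred PLess [t, u]"
abbreviation pr_div :: "nat \<Rightarrow> pr_tm \<Rightarrow> pr_fm" where "pr_div n t \<equiv> Pred (PDiv n) [t]"

text \<open>\<open>n_fold n t\<close> is the term \<open>t + \<dots> + t\<close> with \<open>n\<close> summands, bracketed to the left; the
  empty sum is \<open>0\<close>.\<close>

fun n_fold :: "nat \<Rightarrow> pr_tm \<Rightarrow> pr_tm" where
  "n_fold 0 t = pr_zero"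
| "n_fold (Suc 0) t = t"
| "n_fold (Suc (Suc n)) t = pr_plus (n_fold (Suc n) t) t"

fun Disj :: "('f, 'p) fm list \<Rightarrow> ('f, 'p) fm" where
  "Disj [] = Bot"
| "Disj [A] = A"
| "Disj (A # B # As) = Or A (Disj (B # As))"

fun Conj :: "('f, 'p) fm list \<Rightarrow> ('f, 'p) fm" where
  "Conj [] = Top"
| "Conj [A] = A"
| "Conj (A # B # As) = And A (Conj (B # As))"

abbreviation vx :: pr_tm where "vx \<equiv> Var 0"
abbreviation vy :: pr_tm where "vy \<equiv> Var 1"
abbreviation vz :: pr_tm where "vz \<equiv> Var 2"
abbreviation All_x :: "pr_fm \<Rightarrow> pr_fm" where "All_x A \<equiv> All 0 A"
abbreviation All_xy :: "pr_fm \<Rightarrow> pr_fm" where "All_xy A \<equiv> All 0 (All 1 A)"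
abbreviation All_xyz :: "pr_fm \<Rightarrow> pr_fm" where "All_xyz A \<equiv> All 0 (All 1 (All 2 A))"
abbreviation Ex_y :: "pr_fm \<Rightarrow> pr_fm" where "Ex_y A \<equiv> Ex 1 A"

definition divisibility_axiom :: "nat \<Rightarrow> pr_fm" where
  "divisibility_axiom n = All_x (Iff (pr_div n vx) (Ex_y (Eq vx (n_fold n vy))))"

definition residue_axiom :: "nat \<Rightarrow> pr_fm" where
  "residue_axiom n =
     All_x (Disj (map
       (\<lambda>i. And (pr_div n (pr_plus vx (n_fold i pr_one)))
                (Conj (map (\<lambda>j. Imp (pr_div n (pr_plus vx (n_fold j pr_one))) Bot)
                           (filter (\<lambda>j. j \<noteq> i) [0..<n]))))
       [0..<n]))"

definition presburger :: "pr_fm set" where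
  "presburger =
    { All_x (Imp (pr_less vx vx) Bot),
      All_xy (Or (Eq vx vy) (Or (pr_less vx vy) (pr_less vy vx))),
      All_xyz (Imp (And (pr_less vx vy) (pr_less vy vz)) (pr_less vx vz)),
      All_xyz (Imp (pr_less vx vy) (pr_less (pr_plus vx vz) (pr_plus vy vz))),
      All_xyz (Eq (pr_plus (pr_plus vx vy) vz) (pr_plus vx (pr_plus vy vz))),
      All_x (Eq (pr_plus vx pr_zero) vx),
      All_xy (Eq (pr_plus vx vy) (pr_plus vy vx)),
      pr_less pr_zero pr_one,
      All_x (Or (Or (Eq vx pr_zero) (pr_less vx pr_zero)) (Or (pr_less pr_one vx) (Eq vx pr_one))) }
    \<union> {divisibility_axiom n | n. n > 1}
    \<union> {residue_axiom n | n. n > 1}"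

end

theory Submission imports Defs "HOL-Library.Nat_Bijection"
begin

text \<open>
  The axioms of Presburger arithmetic fix the order \<open><\<close> only at the base world. At a world \<open>t\<close>
  below the base they require just that \<open><\<close> be a translation-invariant strict partial order, which
  heredity makes a suborder of the true one; totality and \<open>0 < 1\<close> are asserted without an
  implication and say nothing about \<open>t\<close>. Over the integers such an order is \<open>y - x \<in> S\<close> for a set
  \<open>S\<close> of positive integers closed under addition, and every such \<open>S\<close> will do.

  Two worlds suffice to exploit this. In the frame of the three-valued logic \<open>RM3\<close> the base \<open>s\<close>
  has a star world \<open>t\<close> below it. Let \<open>M S\<close> be the model on this frame with the integers as domain,
  the true order at \<open>s\<close>, and the order given by \<open>S\<close> at \<open>t\<close>. Since \<open>\<not>\<close> at \<open>s\<close> looks at \<open>t\<close>, the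
  sentence \<open>\<forall>x \<not> 0 < x\<close> holds at \<open>s\<close> in \<open>M S\<close> iff \<open>S\<close> is empty, so it separates \<open>M {}\<close> from
  every \<open>M {N..}\<close> with \<open>N > 0\<close>. A quantifier-free formula \<open>B\<close>, with all its variables set to \<open>0\<close>,
  speaks only about the values of its finitely many terms; if \<open>N\<close> exceeds all of these, then no
  difference of two of them lies in \<open>{N..}\<close>, so \<open>M {N..}\<close> and \<open>M {}\<close> agree on \<open>B\<close>
  (\<open>sat_quantifier_free_eventually\<close>). Hence no \<open>B\<close> is equivalent to the sentence.

  As the frame is an \<open>RM\<close>-frame (\<open>RM_frame_two_world\<close>) and the \<open>M S\<close> are models of the theory
  (\<open>presburger_holds\<close>), the argument covers every logic between \<open>B\<close> and \<open>RM\<close>.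
\<close>

section \<open>The two-world frame\<close>

text \<open>The ternary relation is the largest one in which \<open>s\<close> is not below \<open>t\<close>: all triples but
  \<open>(s, s, t)\<close>. Closing \<open>R s t s\<close>, that is \<open>t \<le> s\<close>, under the conditions on \<open>RM\<close>-frames leaves no
  smaller choice.\<close>

definition two_world_frame :: "'w \<Rightarrow> 'w \<Rightarrow> 'w frame" where
  "two_world_frame s t =
    \<lparr> worlds = {s, t},
      acc = (\<lambda>a b c. a \<in> {s, t} \<and> b \<in> {s, t} \<and> c \<in> {s, t} \<and> \<not> (a = s \<and> b = s \<and> c = t)),
      star = (\<lambda>w. if w = s then t else s),
      base = s \<rparr>"

lemma RM_frame_two_world:
  assumes "s \<noteq> t"
  shows "RM_frame (two_world_frame s t)"
  using assms unfolding RM_frame_def B_frame_def two_world_frame_def Let_def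
  by simp


section \<open>The integers with a weakened order at the star world\<close>

fun int_fun :: "pr_fun \<Rightarrow> int list \<Rightarrow> int" where
  "int_fun PZero zs = 0"
| "int_fun POne zs = 1"
| "int_fun PPlus zs = sum_list zs"

text \<open>The parameter \<open>S\<close> is the set of differences \<open>y - x\<close> for which \<open>x < y\<close> counts as true.\<close>

fun int_pred :: "int set \<Rightarrow> pr_pred \<Rightarrow> int list \<Rightarrow> bool" where
  "int_pred S PLess [x, y] \<longleftrightarrow> y - x \<in> S"
| "int_pred S (PDiv n) [x] \<longleftrightarrow> int n dvd x"
| "int_pred S _ _ \<longleftrightarrow> False"

fun int_val :: "(nat \<Rightarrow> int) \<Rightarrow> pr_tm \<Rightarrow> int" where
  "int_val a (Var x) = a x"
| "int_val a (Fun f ts) = int_fun f (map (int_val a) ts)"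

lemma int_val_nonneg:
  assumes "\<And>x. a x \<ge> 0"
  shows "int_val a t \<ge> 0"
proof (induction t)
  case (Var x)
  show ?case using assms by simp
next
  case (Fun f ts)
  then show ?case by (cases f) (auto intro!: sum_list_nonneg)
qed

text \<open>The injection \<open>e\<close> makes copies of the integers available in any infinite type.\<close>

locale two_world_integers =
  fixes s t :: 'w and e :: "int \<Rightarrow> 'd"
  assumes distinct_worlds: "s \<noteq> t" and inj_e: "inj e"
begin

definition M :: "int set \<Rightarrow> ('w, 'd, pr_fun, pr_pred) model" where
  "M S =
    \<lparr> frame_of = two_world_frame s t,
      domain_of = range e,
      fun_int = (\<lambda>f ds. e (int_fun f (map (inv e) ds))),
      val = (\<lambda>w P. map e ` {zs. int_pred (if w = s then {0<..} else S) P zs}) \<rparr>"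

lemma inv_e [simp]: "inv e (e x) = x"
  using inj_e by simp

lemma e_eq_iff [simp]: "e x = e y \<longleftrightarrow> x = y"
  using inj_e by (simp add: inj_eq)

lemma worlds_simps [simp]: "t \<noteq> s" "s \<noteq> t"
  using distinct_worlds by auto

lemma frame_simps [simp]:
  "worlds (two_world_frame s t) = {s, t}"
  "base (two_world_frame s t) = s"
  "star (two_world_frame s t) s = t"
  "star (two_world_frame s t) t = s"
  "acc (two_world_frame s t) s a b \<longleftrightarrow> a \<in> {s, t} \<and> (b = a \<or> b = s)"
  by (auto simp: two_world_frame_def)

lemma M_simps [simp]:
  "frame_of (M S) = two_world_frame s t"
  "domain_of (M S) = range e"
  "fun_int (M S) f ds = e (int_fun f (map (inv e) ds))"
  by (simp_all add: M_def)

lemma mem_val_M [simp]: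
  "map e zs \<in> val (M S) w P \<longleftrightarrow> int_pred (if w = s then {0<..} else S) P zs"
proof -
  have "inj (map e)" using inj_e by simp
  then show ?thesis by (simp add: M_def inj_image_mem_iff)
qed

lemma mem_val_M_less [simp]:
  "[e x, e y] \<in> val (M S) w PLess \<longleftrightarrow> y - x \<in> (if w = s then {0<..} else S)"
  using mem_val_M[of "[x, y]"] by (simp del: mem_val_M)

lemma mem_val_M_div [simp]:
  "[e x] \<in> val (M S) w (PDiv n) \<longleftrightarrow> int n dvd x"
  using mem_val_M[of "[x]"] by (simp del: mem_val_M)

lemma tm_val_M: "tm_val (M S) (\<lambda>x. e (a x)) u = e (int_val a u)"
proof (induction u)
  case (Fun f us)
  then have "map (inv e) (map (tm_val (M S) (\<lambda>x. e (a x))) us) = map (int_val a) us"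
    by simp
  then show ?case by (simp del: map_map)
qed simp

lemma tm_val_n_fold:
  assumes "tm_val (M S) a u = e x"
  shows "tm_val (M S) a (n_fold n u) = e (int n * x)"
  using assms by (induction n u rule: n_fold.induct) (simp_all add: algebra_simps)

text \<open>Divisibility comes out the same at both worlds, so only the order can break heredity.\<close>

lemma B_model_M:
  assumes "S \<subseteq> {0<..}"
  shows "B_model pr_sig (M S)"
proof -
  have mono: "int_pred S P zs \<Longrightarrow> int_pred {0<..} P zs" for P zs
    using assms by (cases "(S, P, zs)" rule: int_pred.cases) auto
  have arity: "length zs = n"
    if "pred_arity pr_sig P = Some n" "int_pred T P zs" for P n T zs
    using that by (cases "(T, P, zs)" rule: int_pred.cases) (auto simp: pr_sig_def split: if_splits)
  have val: "val (M S) w P = map e ` {zs. int_pred (if w = s then {0<..} else S) P zs}" for w P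
    by (simp add: M_def)
  have "B_frame (frame_of (M S))"
    using RM_frame_two_world[OF distinct_worlds] by (simp add: RM_frame_def Let_def)
  moreover have "val (M S) w P \<subseteq> {ds. length ds = n \<and> set ds \<subseteq> range e}"
    if "pred_arity pr_sig P = Some n" for w P n
    using arity[OF that] by (auto simp: val)
  moreover have "val (M S) w P \<subseteq> val (M S) s P" for w P
    using mono by (auto simp: val)
  ultimately show ?thesis
    unfolding B_model_def Let_def by auto
qed


section \<open>The models satisfy Presburger arithmetic\<close>

lemma sat_Disj: "sat N w a (Disj As) \<longleftrightarrow> (\<exists>A\<in>set As. sat N w a A)"
  by (induction As rule: Disj.induct) auto

lemma sat_Conj: "sat N w a (Conj As) \<longleftrightarrow> (\<forall>A\<in>set As. sat N w a A)"
  by (induction As rule: Conj.induct) auto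

lemma divisibility_axiom_holds: "holds_at (M S) s (divisibility_axiom n)"
  by (auto simp: holds_at_def divisibility_axiom_def Iff_def tm_val_n_fold dvd_def)

lemma residue_axiom_holds:
  assumes "n > 1"
  shows "holds_at (M S) s (residue_axiom n)"
proof -
  have "\<exists>i<n. int n dvd x + int i \<and> (\<forall>j. j < n \<and> j \<noteq> i \<longrightarrow> \<not> int n dvd x + int j)" for x :: int
  proof -
    define i where "i = nat ((- x) mod int n)"
    have i: "int i = (- x) mod int n" "i < n"
      using assms by (auto simp: i_def nat_less_iff)
    have "int n dvd x + int i"
      unfolding i(1) by (simp add: dvd_eq_mod_eq_0 mod_simps)
    moreover have "j = i" if "j < n" "int n dvd x + int j" for j
    proof -
      have "int n dvd int j - int i"
        using dvd_diff[OF that(2) \<open>int n dvd x + int i\<close>] by simp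
      then have "int j mod int n = int i mod int n"
        by (simp add: mod_eq_dvd_iff)
      then show ?thesis using that(1) i(2) by simp
    qed
    ultimately show ?thesis using i(2) by blast
  qed
  then show ?thesis
    by (auto simp: holds_at_def residue_axiom_def sat_Disj sat_Conj tm_val_n_fold Bex_def)
qed

text \<open>Closure of \<open>S\<close> under addition is transitivity of the order at \<open>t\<close>; positivity gives its
  irreflexivity there, and also the instances of the implications that lead from \<open>t\<close> to \<open>s\<close>.\<close>

lemma presburger_holds:
  assumes pos: "S \<subseteq> {0<..}"
    and add: "\<And>x y. x \<in> S \<Longrightarrow> y \<in> S \<Longrightarrow> x + y \<in> S"
    and G: "G \<in> presburger"
  shows "holds_at (M S) s G"
proof -
  have less: "x < y" if "y - x \<in> S" for x y
    using that pos by auto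
  have irrefl: "0 \<notin> S" using pos by auto
  have trans: "z - x \<in> S" if "y - x \<in> S" "z - y \<in> S" for x y z
    using add[OF that] by simp
  from G consider (divisibility) n where "G = divisibility_axiom n"
    | (residue) n where "n > 1" "G = residue_axiom n"
    | (order) "G \<in> presburger - {divisibility_axiom n | n. n > 1} - {residue_axiom n | n. n > 1}"
    by blast
  then show ?thesis
  proof cases
    case divisibility
    then show ?thesis by (simp add: divisibility_axiom_holds)
  next
    case residue
    then show ?thesis by (simp add: residue_axiom_holds)
  next
    case order
    then show ?thesis
      unfolding presburger_def
      by (elim DiffE UnE insertE emptyE)
        (auto simp: holds_at_def irrefl intro: trans less[OF trans] dest: less)
  qed
qed


section \<open>The separating sentence\<close>

definition no_positive :: pr_fm where
  "no_positive = All_x (Neg (pr_less pr_zero vx))"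

lemma sat_no_positive: "sat (M S) s a no_positive \<longleftrightarrow> S = {}"
  by (auto simp: no_positive_def)

text \<open>With all variables set to \<open>0\<close>, term values are nonnegative; a difference of two of them is
  therefore at most the minuend, and a bound on single values suffices.\<close>

lemma sat_quantifier_free_eventually:
  assumes "quantifier_free B"
  shows "\<exists>K. \<forall>N\<ge>K. \<forall>w\<in>{s, t}.
           sat (M {N..}) w (\<lambda>_. e 0) B \<longleftrightarrow> sat (M {}) w (\<lambda>_. e 0) B"
    (is "\<exists>K. \<forall>N\<ge>K. ?agree N B")
proof -
  have binary: "\<exists>K. \<forall>N\<ge>K. ?agree N C"
    if "\<exists>K. \<forall>N\<ge>K. ?agree N A" "\<exists>K. \<forall>N\<ge>K. ?agree N B"
      and step: "\<And>N. ?agree N A \<Longrightarrow> ?agree N B \<Longrightarrow> ?agree N C" for A B C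
  proof -
    from that(1,2) obtain K L where "\<forall>N\<ge>K. ?agree N A" "\<forall>N\<ge>L. ?agree N B"
      by blast
    then have "?agree N C" if "N \<ge> max K L" for N
      using that by (intro step) simp_all
    then show ?thesis by blast
  qed
  have tm: "tm_val (M S) (\<lambda>_. e 0) = e \<circ> int_val (\<lambda>_. 0)" for S
    using tm_val_M[of S "\<lambda>_. 0"] by auto
  show ?thesis using assms
  proof (induction B)
    case (Pred P us)
    let ?zs = "map (int_val (\<lambda>_. 0)) us"
    have "\<exists>K. \<forall>N\<ge>K. int_pred {N..} P ?zs \<longleftrightarrow> int_pred {} P ?zs"
      \<comment> \<open>The set \<open>UNIV\<close> is a dummy; the case split is on the shape of the predicate and its arguments.\<close>
    proof (cases "(UNIV :: int set, P, ?zs)" rule: int_pred.cases)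
      case (1 S x y)
      then have "x \<ge> 0" using int_val_nonneg[of "\<lambda>_. 0"] by auto
      then have "\<forall>N\<ge>y + 1. int_pred {N..} P ?zs \<longleftrightarrow> int_pred {} P ?zs"
        using 1 by auto
      then show ?thesis by blast
    qed auto
    then obtain K where "\<forall>N\<ge>K. int_pred {N..} P ?zs \<longleftrightarrow> int_pred {} P ?zs" ..
    then have "\<forall>N\<ge>K. ?agree N (Pred P us)"
      by (simp add: tm flip: map_map)
    then show ?case by blast
  next
    case (Neg A)
    then show ?case by auto
  next
    case (And A B)
    show ?case by (rule binary[of A B]) (use And in auto)
  next
    case (Or A B)
    show ?case by (rule binary[of A B]) (use Or in auto)
  next
    case (Imp A B)
    show ?case by (rule binary[of A B]) (use Imp in auto)
  qed (simp_all add: tm)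
qed

end


section \<open>Failure of quantifier elimination\<close>

text \<open>At the base, \<open>R s s s\<close> lets the intensional biconditional be read classically. Elsewhere it
  need not be: \<open>R w w w\<close> can fail in a \<open>B\<close>-frame.\<close>

lemma sat_IffD:
  assumes "B_model \<Sigma> N" and "sat N (base (frame_of N)) a (Iff A B)"
  shows "sat N (base (frame_of N)) a A \<longleftrightarrow> sat N (base (frame_of N)) a B"
proof -
  let ?s = "base (frame_of N)"
  have "B_frame (frame_of N)"
    using assms(1) unfolding B_model_def Let_def by (elim conjE)
  then have "?s \<in> worlds (frame_of N) \<and> (\<forall>\<alpha>\<in>worlds (frame_of N). acc (frame_of N) ?s \<alpha> \<alpha>)"
    unfolding B_frame_def Let_def by (elim conjE, intro conjI)
  then have frame: "?s \<in> worlds (frame_of N)" "acc (frame_of N) ?s ?s ?s"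
    by simp_all
  have "sat N ?s a (Imp A B)" "sat N ?s a (Imp B A)"
    using assms(2) by (simp_all only: Iff_def sat.simps(6))
  then show ?thesis
    unfolding sat.simps(8) using frame by blast
qed

theorem theorem9:
  fixes L :: "'w frame set"
  assumes "infinite (UNIV :: 'w set)"
    and "infinite (UNIV :: 'd set)"
    and "between_B_and_RM L"
  shows "\<exists>A. formula_of pr_sig A \<and>
           \<not> (\<exists>B. formula_of pr_sig B \<and> quantifier_free B \<and>
                  consequence TYPE('d) pr_sig L presburger (Iff A B))"
proof -
  obtain s t :: 'w where "s \<noteq> t"
    using ex_new_if_finite[OF assms(1), of "{undefined}"] by auto
  obtain g :: "nat \<Rightarrow> 'd" where g: "inj g"
    using infinite_countable_subset[OF assms(2)] by blast
  obtain e :: "int \<Rightarrow> 'd" where "inj e"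
    using inj_compose[OF g inj_int_encode] by blast
  with \<open>s \<noteq> t\<close> interpret two_world_integers s t e
    by unfold_locales
  have "\<not> consequence TYPE('d) pr_sig L presburger (Iff no_positive B)"
    if qf: "quantifier_free B" for B
  proof
    assume cons: "consequence TYPE('d) pr_sig L presburger (Iff no_positive B)"
    have iff: "sat (M S) s (\<lambda>_. e 0) B \<longleftrightarrow> S = {}"
      if "S \<subseteq> {0<..}" "\<And>x y. x \<in> S \<Longrightarrow> y \<in> S \<Longrightarrow> x + y \<in> S" for S
    proof -
      have model: "B_model pr_sig (M S)" by (rule B_model_M) fact
      have "frame_of (M S) \<in> L"
        using assms(3) RM_frame_two_world[OF distinct_worlds]
        by (simp add: between_B_and_RM_def)
      then have "holds_at (M S) s (Iff no_positive B)"
        using cons[unfolded consequence_def, rule_format, of "M S"] model presburger_holds[OF that]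
        by simp
      then have "sat (M S) s (\<lambda>_. e 0) (Iff no_positive B)"
        by (simp add: holds_at_def assignment_def)
      then show ?thesis
        using sat_IffD[OF model, of "\<lambda>_. e 0" no_positive B] by (simp add: sat_no_positive)
    qed
    obtain K where K: "\<forall>N\<ge>K. \<forall>w\<in>{s, t}.
        sat (M {N..}) w (\<lambda>_. e 0) B \<longleftrightarrow> sat (M {}) w (\<lambda>_. e 0) B"
      using sat_quantifier_free_eventually[OF qf] ..
    \<comment> \<open>Besides \<open>N \<ge> K\<close>, the set \<open>{N..}\<close> must consist of positive integers.\<close>
    define N where "N = max K 1"
    then have "N \<ge> 1" by simp
    have "sat (M {N..}) s (\<lambda>_. e 0) B \<longleftrightarrow> sat (M {}) s (\<lambda>_. e 0) B"
      using K[rule_format, of N s] by (simp add: N_def)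
    moreover have "\<not> sat (M {N..}) s (\<lambda>_. e 0) B"
      using \<open>N \<ge> 1\<close> by (subst iff) auto
    moreover have "sat (M {}) s (\<lambda>_. e 0) B"
      using iff[of "{}"] by simp
    ultimately show False by blast
  qed
  moreover have "formula_of pr_sig no_positive"
    by (simp add: no_positive_def pr_sig_def)
  ultimately show ?thesis by blast
qed

end
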